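(* Let $\mathbb{K}$ be an algebraically closed field, let $m>1$ be an odd integer, let $q\in\mathbb{K}^*$ be a primitive $m$-th root of unity, and let $n\ge 1$. Then in $\mathcal{O}_q(\mathfrak{o}\mathbb{K}^{2n})$, for each $i=1,\dots,n$, $$\omega_i^m=(1-q^{-2})^m\sum_{l\le i}y_l^mx_l^m.$$
   Context: The coordinate ring $\mathcal{O}_{q}(\mathfrak{o}\mathbb{K}^{2n})$ of quantum euclidean $2n$-space is the associative unital $\mathbb{K}$-algebra generated by $x_1,\dots,x_n,y_1,\dots,y_n$ subject to the relations $x_ix_j=q\,x_jx_i$ for all $i<j$; $y_iy_j=q^{-1}y_jy_i$ for all $i<j$; $x_iy_j=q^{-1}y_jx_i$ for all $i\neq j$; and $x_iy_i=y_ix_i+\sum_{l<i}(1-q^{-2})y_lx_l$ for all $i$. For $1\le i\le n$ put $\omega_i:=\sum_{l\le i}(1-q^{-2})y_lx_l$. *)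

theory Defs
  imports
    "HOL-Library.Poly_Mapping"
    "HOL-Computational_Algebra.Polynomial"
    "HOL-Algebra.Module"
    "HOL-Algebra.QuotRing"
begin

definition primitive_root_of_unity :: "nat \<Rightarrow> 'k::field \<Rightarrow> bool" where
  "primitive_root_of_unity m q \<longleftrightarrow> 0 < m \<and> q ^ m = 1 \<and> (\<forall>k. 0 < k \<and> k < m \<longrightarrow> q ^ k \<noteq> 1)"

text \<open>The free monoid of words. It is written additively (concatenation as \<open>+\<close>) so that
  \<open>'a word \<Rightarrow>\<^sub>0 'k\<close>, with the convolution product of finitely supported functions, is the
  free associative unital \<open>'k\<close>-algebra.\<close>

datatype 'a word = Word (letters: "'a list")

instantiation word :: (type) monoid_add
begin

definition zero_word :: "'a word" where "0 = Word []"

definition plus_word :: "'a word \<Rightarrow> 'a word \<Rightarrow> 'a word" where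
  "u + v = Word (letters u @ letters v)"

instance by standard (simp_all add: zero_word_def plus_word_def)

end

definition scalar :: "'k::field \<Rightarrow> 'a word \<Rightarrow>\<^sub>0 'k" where
  "scalar c = Poly_Mapping.single 0 c"

definition generator :: "'a \<Rightarrow> 'a word \<Rightarrow>\<^sub>0 'k::field" where
  "generator g = Poly_Mapping.single (Word [g]) 1"

definition free_algebra :: "'a set \<Rightarrow> ('k::field, 'a word \<Rightarrow>\<^sub>0 'k) module" where
  "free_algebra S =
     \<lparr>carrier = {f. \<forall>w\<in>Poly_Mapping.keys f. set (letters w) \<subseteq> S},
      mult = (*), one = 1, zero = 0, add = (+), smult = (\<lambda>c f. scalar c * f)\<rparr>"

text \<open>The scalar action on cosets is defined like the product \<^const>\<open>rcoset_mult\<close>.\<close>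

definition quotient_algebra :: "('k, 'b) module \<Rightarrow> 'b set \<Rightarrow> ('k, 'b set) module" where
  "quotient_algebra A I =
     ring.extend (A Quot I) (module.fields (\<lambda>c X. \<Union>a\<in>X. I +>\<^bsub>A\<^esub> (c \<odot>\<^bsub>A\<^esub> a)))"

datatype gen = GX nat | GY nat

abbreviation fX :: "nat \<Rightarrow> gen word \<Rightarrow>\<^sub>0 'k::field" where "fX i \<equiv> generator (GX i)"
abbreviation fY :: "nat \<Rightarrow> gen word \<Rightarrow>\<^sub>0 'k::field" where "fY i \<equiv> generator (GY i)"

definition oq_gens :: "nat \<Rightarrow> gen set" where
  "oq_gens n = GX ` {1..n} \<union> GY ` {1..n}"

text \<open>A defining relation \<open>a = b\<close> is represented by \<open>a - b\<close>.\<close>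

definition oq_relators :: "nat \<Rightarrow> 'k::field \<Rightarrow> (gen word \<Rightarrow>\<^sub>0 'k) set" where
  "oq_relators n q =
     {fX i * fX j - scalar q * (fX j * fX i) | i j.
        i \<in> {1..n} \<and> j \<in> {1..n} \<and> i < j} \<union>
     {fY i * fY j - scalar (inverse q) * (fY j * fY i) | i j.
        i \<in> {1..n} \<and> j \<in> {1..n} \<and> i < j} \<union>
     {fX i * fY j - scalar (inverse q) * (fY j * fX i) | i j.
        i \<in> {1..n} \<and> j \<in> {1..n} \<and> i \<noteq> j} \<union>
     {fX i * fY i - (fY i * fX i + (\<Sum>l\<in>{1..<i}. scalar (1 - q powi (-2)) * (fY l * fX l))) | i.
        i \<in> {1..n}}"

definition oq_ideal :: "nat \<Rightarrow> 'k::field \<Rightarrow> (gen word \<Rightarrow>\<^sub>0 'k) set" where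
  "oq_ideal n q = Idl\<^bsub>free_algebra (oq_gens n)\<^esub> (oq_relators n q)"

definition Oq :: "nat \<Rightarrow> 'k::field \<Rightarrow> ('k, (gen word \<Rightarrow>\<^sub>0 'k) set) module" where
  "Oq n q = quotient_algebra (free_algebra (oq_gens n)) (oq_ideal n q)"

definition oq_x :: "nat \<Rightarrow> 'k::field \<Rightarrow> nat \<Rightarrow> (gen word \<Rightarrow>\<^sub>0 'k) set" where
  "oq_x n q i = oq_ideal n q +>\<^bsub>free_algebra (oq_gens n)\<^esub> fX i"

definition oq_y :: "nat \<Rightarrow> 'k::field \<Rightarrow> nat \<Rightarrow> (gen word \<Rightarrow>\<^sub>0 'k) set" where
  "oq_y n q i = oq_ideal n q +>\<^bsub>free_algebra (oq_gens n)\<^esub> fY i"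

definition oq_omega :: "nat \<Rightarrow> 'k::field \<Rightarrow> nat \<Rightarrow> (gen word \<Rightarrow>\<^sub>0 'k) set" where
  "oq_omega n q i =
     (\<Oplus>\<^bsub>Oq n q\<^esub>l\<in>{1..i}. (1 - q powi (-2)) \<odot>\<^bsub>Oq n q\<^esub> (oq_y n q l \<otimes>\<^bsub>Oq n q\<^esub> oq_x n q l))"

end

theory Submission
  imports Defs
begin

text \<open>
  Put \<open>c = 1 - q\<^sup>-\<^sup>2\<close>, \<open>a = \<omega>\<^sub>i\<^sub>-\<^sub>1\<close>, \<open>w = \<omega>\<^sub>i = a + c y\<^sub>i x\<^sub>i\<close>. The relations give \<open>y\<^sub>i a = q\<^sup>2 a y\<^sub>i\<close>,
  \<open>a w = w a\<close> and \<open>y\<^sub>i w = w y\<^sub>i\<close>. As \<open>c y\<^sub>i x\<^sub>i = w - a\<close>, moving powers of \<open>y\<^sub>i\<close> to the right yields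
  \<open>c\<^sup>k y\<^sub>i\<^sup>k x\<^sub>i\<^sup>k = (w - a) (w - q\<^sup>2 a) \<dots> (w - q\<^bsup>2(k-1)\<^esup> a)\<close>. For odd \<open>m\<close>, \<open>q\<^sup>2\<close> is again a
  primitive \<open>m\<close>-th root of unity, so for \<open>k = m\<close> the product is \<open>w\<^sup>m - a\<^sup>m\<close>, and the formula
  telescopes.
\<close>

section \<open>Homogenised polynomials over an associative algebra\<close>

text \<open>The scalars are a whole type rather than a carrier set. Both the free algebra and its
  quotient are instances, so the computation can be done once, away from cosets.\<close>

locale assoc_algebra = ring A for A :: "('k::field, 'a) module" (structure) +
  assumes smult_closed [simp, intro]: "u \<in> carrier A \<Longrightarrow> c \<odot> u \<in> carrier A"
    and smult_add_left: "u \<in> carrier A \<Longrightarrow> (c + d) \<odot> u = c \<odot> u \<oplus> d \<odot> u"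
    and smult_add_right:
      "u \<in> carrier A \<Longrightarrow> v \<in> carrier A \<Longrightarrow> c \<odot> (u \<oplus> v) = c \<odot> u \<oplus> c \<odot> v"
    and smult_smult [simp]: "u \<in> carrier A \<Longrightarrow> c \<odot> (d \<odot> u) = (c * d) \<odot> u"
    and smult_one [simp]: "u \<in> carrier A \<Longrightarrow> 1 \<odot> u = u"
    and smult_mult_left [simp]:
      "u \<in> carrier A \<Longrightarrow> v \<in> carrier A \<Longrightarrow> (c \<odot> u) \<otimes> v = c \<odot> (u \<otimes> v)"
    and smult_mult_right [simp]:
      "u \<in> carrier A \<Longrightarrow> v \<in> carrier A \<Longrightarrow> u \<otimes> (c \<odot> v) = c \<odot> (u \<otimes> v)"
begin

lemma smult_zero_left [simp]:
  assumes "u \<in> carrier A"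
  shows "0 \<odot> u = \<zero>"
  using smult_add_left[OF assms, of 0 0] assms by simp

lemma smult_zero_right [simp]: "c \<odot> \<zero> = \<zero>"
  using smult_add_right[of \<zero> \<zero> c] by simp

text \<open>The homogenisation of \<open>p\<close> in degree \<open>r\<close>, \<open>\<Sum>j\<le>r. p\<^sub>j w\<^sup>j a\<^sup>r\<^sup>-\<^sup>j\<close>, evaluated at \<open>w\<close> and \<open>a\<close>;
  coefficients of \<open>p\<close> beyond \<open>r\<close> are ignored.\<close>

primrec hom_eval :: "'a \<Rightarrow> 'a \<Rightarrow> nat \<Rightarrow> 'k poly \<Rightarrow> 'a" where
  "hom_eval w a 0 p = coeff p 0 \<odot> \<one>"
| "hom_eval w a (Suc r) p = hom_eval w a r p \<otimes> a \<oplus> coeff p (Suc r) \<odot> (w [^] Suc r)"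

context
  fixes w a
  assumes w [simp]: "w \<in> carrier A" and a [simp]: "a \<in> carrier A"
begin

lemma hom_eval_closed [simp]: "hom_eval w a r p \<in> carrier A"
  by (induction r) (simp_all del: nat_pow_Suc)

lemma hom_eval_add: "hom_eval w a r (p + p') = hom_eval w a r p \<oplus> hom_eval w a r p'"
  by (induction r) (simp_all add: smult_add_left l_distr a_ac del: nat_pow_Suc)

lemma hom_eval_smult: "hom_eval w a r (Polynomial.smult c p) = c \<odot> hom_eval w a r p"
  by (induction r) (simp_all add: smult_add_right del: nat_pow_Suc)

lemma hom_eval_degree_le: "degree p \<le> r \<Longrightarrow> hom_eval w a (Suc r) p = hom_eval w a r p \<otimes> a"
  by (simp add: coeff_eq_0)

lemma hom_eval_1: "hom_eval w a r 1 = a [^] r"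
  by (induction r) (simp_all add: coeff_eq_0)

text \<open>Multiplying the polynomial by its variable becomes left multiplication by
  \<open>w\<close>, because in every term the powers of \<open>w\<close> stand to the left of those
  of \<open>a\<close>.\<close>

lemma hom_eval_pCons_0: "hom_eval w a (Suc r) (pCons 0 p) = w \<otimes> hom_eval w a r p"
proof (induction r)
  case 0
  then show ?case by simp
next
  case (Suc r)
  have "hom_eval w a (Suc (Suc r)) (pCons 0 p)
      = w \<otimes> hom_eval w a r p \<otimes> a \<oplus> coeff p (Suc r) \<odot> (w \<otimes> w [^] Suc r)"
    unfolding hom_eval.simps(2)[of w a "Suc r"] Suc.IH nat_pow_Suc2[OF w, of "Suc r"] by simp
  also have "\<dots> = w \<otimes> hom_eval w a (Suc r) p"
    by (simp add: r_distr m_assoc del: nat_pow_Suc)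
  finally show ?case .
qed

lemma hom_eval_monom: "hom_eval w a r (monom 1 r) = w [^] r"
proof (induction r)
  case 0
  then show ?case by simp
next
  case (Suc r)
  show ?case
    unfolding monom_Suc hom_eval_pCons_0 Suc.IH nat_pow_Suc2[OF w] ..
qed

context
  assumes comm: "a \<otimes> w = w \<otimes> a"
begin

text \<open>Every term is a product of powers of \<open>w\<close> and \<open>a\<close>, both of
  which commute with \<open>a\<close>.\<close>

lemma hom_eval_commute: "a \<otimes> hom_eval w a r p = hom_eval w a r p \<otimes> a"
proof (induction r)
  case 0
  then show ?case by simp
next
  case (Suc r)
  have "a \<otimes> w [^] Suc r = w [^] Suc r \<otimes> a"
    using comm group_commutes_pow[of w a "Suc r"] by simp
  then show ?case
    using Suc by (simp add: r_distr l_distr m_assoc[symmetric] del: nat_pow_Suc)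
qed

text \<open>The variable contributes \<open>w\<close> on the left. The constant \<open>- c\<close>
  raises the degree by a factor \<open>a\<close> on the right, which commutation brings to the left;
  the degree bound ensures that the new top coefficient of \<open>p\<close> is zero.\<close>

lemma hom_eval_linear_mult:
  assumes "degree p \<le> r"
  shows "hom_eval w a (Suc r) ([:- c, 1:] * p) = (w \<oplus> (- c) \<odot> a) \<otimes> hom_eval w a r p"
proof -
  have "[:- c, 1:] * p = Polynomial.smult (- c) p + pCons 0 p"
    by simp
  then show ?thesis
    using assms
    by (simp only: hom_eval_add hom_eval_smult hom_eval_degree_le hom_eval_pCons_0)
       (simp add: l_distr hom_eval_commute a_comm)
qed

end

end

end

section \<open>Primitive roots of unity\<close>

text \<open>Both sides have degree at most \<open>m\<close>, agree in the coefficient at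
  \<open>m\<close>, and vanish at the \<open>m\<close> distinct powers of \<open>z\<close>.\<close>

lemma prod_roots_of_unity:
  fixes z :: "'k::field"
  assumes "primitive_root_of_unity m z"
  shows "(\<Prod>j<m. [:- (z ^ j), 1:]) = monom 1 m - 1"
proof (rule poly_eqI_degree_lead_coeff[where n = m and A = "(\<lambda>j. z ^ j) ` {..<m}"])
  let ?P = "\<Prod>j<m. [:- (z ^ j), 1:]"
  have m: "0 < m" and zm: "z ^ m = 1" and prim: "\<And>k. 0 < k \<Longrightarrow> k < m \<Longrightarrow> z ^ k \<noteq> 1"
    using assms by (auto simp: primitive_root_of_unity_def)
  then have z: "z \<noteq> 0"
    by (metis power_0_left not_less_zero zero_neq_one)
  have deg: "degree ?P = m"
    by (subst degree_prod_eq_sum_degree) auto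
  then show "degree ?P \<le> m"
    by simp
  show "coeff ?P m = coeff (monom 1 m - 1) m"
    using lead_coeff_prod[of "\<lambda>j. [:- (z ^ j), 1:]" "{..<m}"] deg m by (simp add: coeff_eq_0)
  show "degree (monom 1 m - 1 :: 'k poly) \<le> m"
    by (intro degree_diff_le) (auto simp: degree_monom_le)
  \<comment> \<open>A coincidence of two powers would give \<open>z ^ (k - j) = 1\<close> with an
    exponent strictly between 0 and \<open>m\<close>.\<close>
  have "inj_on (\<lambda>j. z ^ j) {..<m}"
  proof (rule linorder_inj_onI)
    fix j k assume "j < k" "j \<in> {..<m}" "k \<in> {..<m}"
    then have "z ^ (k - j) \<noteq> 1"
      by (intro prim) auto
    then show "z ^ j \<noteq> z ^ k"
      using z \<open>j < k\<close> by (simp add: power_diff)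
  qed auto
  then show "m \<le> card ((\<lambda>j. z ^ j) ` {..<m})"
    by (simp add: card_image)
  fix t assume "t \<in> (\<lambda>j. z ^ j) ` {..<m}"
  then obtain j where j: "j < m" "t = z ^ j"
    by auto
  moreover have "(z ^ j) ^ m = 1"
    by (metis zm power_one mult.commute power_mult)
  ultimately show "poly ?P t = poly (monom 1 m - 1) t"
    by (auto simp: poly_prod poly_monom)
qed

text \<open>If \<open>q ^ (2 * k) = 1\<close> with 0 < k < m, then 2k < m contradicts primitivity,
  2k = m contradicts parity, and 2k > m leaves the exponent 2k - m, again strictly between 0 and
  \<open>m\<close>.\<close>

lemma primitive_root_of_unity_square:
  assumes "primitive_root_of_unity m q" "odd m"
  shows "primitive_root_of_unity m (q ^ 2)"
proof -
  have m: "0 < m" and qm: "q ^ m = 1" and prim: "\<And>k. 0 < k \<Longrightarrow> k < m \<Longrightarrow> q ^ k \<noteq> 1"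
    using assms by (auto simp: primitive_root_of_unity_def)
  have "(q ^ 2) ^ k \<noteq> 1" if k: "0 < k" "k < m" for k
  proof
    assume "(q ^ 2) ^ k = 1"
    then have eq: "q ^ (2 * k) = 1"
      by (simp add: power_mult)
    then have "\<not> 2 * k < m"
      using prim[of "2 * k"] k by auto
    moreover have "2 * k \<noteq> m"
      using \<open>odd m\<close> by auto
    ultimately have lt: "m < 2 * k"
      by simp
    then have "q ^ (2 * k) = q ^ (2 * k - m) * q ^ m"
      by (simp flip: power_add)
    then have "q ^ (2 * k - m) = 1"
      using eq qm by simp
    then show False
      using prim[of "2 * k - m"] lt k by auto
  qed
  moreover have "(q ^ 2) ^ m = 1"
    using qm by (metis mult.commute power_mult power_one)
  ultimately show ?thesis
    using m by (auto simp: primitive_root_of_unity_def)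
qed

section \<open>The power formula from the defining relations\<close>

context assoc_algebra
begin

text \<open>The passage from one index to the next. The previous sum enters only as an element
  \<open>a\<close> that commutes with \<open>x\<close> and \<open>y\<close> up to
  \<open>q ^ 2\<close>.\<close>

lemma scaled_product_power:
  fixes q :: 'k
  assumes [simp]: "x \<in> carrier A" "y \<in> carrier A" "a \<in> carrier A"
    and q: "q \<noteq> 0" and prim: "primitive_root_of_unity m (q ^ 2)"
    and xy: "x \<otimes> y = y \<otimes> x \<oplus> a"
    and ax: "a \<otimes> x = q ^ 2 \<odot> (x \<otimes> a)"
    and ya: "y \<otimes> a = q ^ 2 \<odot> (a \<otimes> y)"
    and c: "c = 1 - inverse (q ^ 2)"
    and w: "w = a \<oplus> c \<odot> (y \<otimes> x)"
  shows "w [^] m = a [^] m \<oplus> c ^ m \<odot> (y [^] m \<otimes> x [^] m)"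
proof -
  have [simp]: "w \<in> carrier A"
    by (simp add: w)
  have ay: "a \<otimes> y = inverse (q ^ 2) \<odot> (y \<otimes> a)"
    using q by (simp add: ya)
  \<comment> \<open>The factors from moving \<open>a\<close> past \<open>y\<close> and past
    \<open>x\<close> are inverse to each other, so \<open>a\<close> commutes with
    \<open>y \<otimes> x\<close>.\<close>
  have "a \<otimes> (y \<otimes> x) = inverse (q ^ 2) \<odot> (y \<otimes> (a \<otimes> x))"
    by (simp add: m_assoc[symmetric] ay)
  also have "\<dots> = (y \<otimes> x) \<otimes> a"
    using q by (simp add: ax m_assoc)
  finally have aw: "a \<otimes> w = w \<otimes> a"
    by (simp add: w l_distr r_distr)
  \<comment> \<open>The value of \<open>c\<close> is chosen so that
    \<open>inverse (q ^ 2) + c = 1\<close>, which restores the summand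
    \<open>y \<otimes> a\<close>.\<close>
  have "w \<otimes> y = inverse (q ^ 2) \<odot> (y \<otimes> a) \<oplus> c \<odot> (y \<otimes> (y \<otimes> x \<oplus> a))"
    by (simp add: w l_distr m_assoc xy ay)
  also have "\<dots> = (inverse (q ^ 2) + c) \<odot> (y \<otimes> a) \<oplus> c \<odot> (y \<otimes> (y \<otimes> x))"
    by (simp add: r_distr smult_add_left smult_add_right a_ac)
  also have "\<dots> = y \<otimes> w"
    by (simp add: c w r_distr)
  finally have wy: "w \<otimes> y = y \<otimes> w" .
  \<comment> \<open>Since \<open>y\<close> commutes with \<open>w\<close>, only the summand
    \<open>a\<close> of w - a picks up a factor \<open>q ^ 2\<close> for each
    \<open>y\<close>.\<close>
  have shift: "y [^] k \<otimes> (c \<odot> (y \<otimes> x)) = (w \<oplus> (- ((q ^ 2) ^ k)) \<odot> a) \<otimes> y [^] k" for k :: nat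
  proof (induction k)
    case 0
    \<comment> \<open>Writing \<open>a\<close> as \<open>1 \<odot> a\<close> lets the two multiples
      of \<open>a\<close> cancel by adding their scalars.\<close>
    have "w \<oplus> (- 1) \<odot> a = c \<odot> (y \<otimes> x) \<oplus> (1 \<odot> a \<oplus> (- 1) \<odot> a)"
      by (simp add: w a_ac)
    also have "\<dots> = c \<odot> (y \<otimes> x)"
      by (simp only: smult_add_left[symmetric] assms) simp
    finally show ?case
      by simp
  next
    case (Suc k)
    have "y [^] Suc k \<otimes> (c \<odot> (y \<otimes> x)) = y \<otimes> (y [^] k \<otimes> (c \<odot> (y \<otimes> x)))"
      by (simp only: nat_pow_Suc2 assms) (simp add: m_assoc)
    also have "\<dots> = y \<otimes> (w \<oplus> (- ((q ^ 2) ^ k)) \<odot> a) \<otimes> y [^] k"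
      unfolding Suc.IH by (simp add: m_assoc)
    also have "y \<otimes> (w \<oplus> (- ((q ^ 2) ^ k)) \<odot> a) = (w \<oplus> (- ((q ^ 2) ^ Suc k)) \<odot> a) \<otimes> y"
      by (simp add: r_distr l_distr wy ya mult.commute)
    also have "\<dots> \<otimes> y [^] k = (w \<oplus> (- ((q ^ 2) ^ Suc k)) \<odot> a) \<otimes> y [^] Suc k"
      by (simp only: nat_pow_Suc2 assms) (simp add: m_assoc)
    finally show ?case .
  qed
  have "c ^ k \<odot> (y [^] k \<otimes> x [^] k) = hom_eval w a k (\<Prod>j<k. [:- ((q ^ 2) ^ j), 1:])" for k
  proof (induction k)
    case 0
    then show ?case by simp
  next
    case (Suc k)
    let ?P = "\<Prod>j<k. [:- ((q ^ 2) ^ j), 1:]"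
    have "degree ?P \<le> k"
      by (subst degree_prod_eq_sum_degree) auto
    then have "hom_eval w a (Suc k) (\<Prod>j<Suc k. [:- ((q ^ 2) ^ j), 1:])
        = (w \<oplus> (- ((q ^ 2) ^ k)) \<odot> a) \<otimes> (c ^ k \<odot> (y [^] k \<otimes> x [^] k))"
      unfolding Suc.IH prod.lessThan_Suc mult.commute[of ?P]
      by (intro hom_eval_linear_mult aw) simp_all
    also have "\<dots> = c ^ k \<odot> ((w \<oplus> (- ((q ^ 2) ^ k)) \<odot> a) \<otimes> y [^] k \<otimes> x [^] k)"
      by (simp add: m_assoc)
    \<comment> \<open>Read backwards, \<open>shift\<close> turns the new linear factor into a pair
      \<open>y \<otimes> x\<close> between the powers of \<open>y\<close> and
      \<open>x\<close>.\<close>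
    also have "\<dots> = c ^ Suc k \<odot> (y [^] k \<otimes> (y \<otimes> x) \<otimes> x [^] k)"
      unfolding shift[symmetric] by (simp add: mult.commute)
    also have "\<dots> = c ^ Suc k \<odot> (y [^] Suc k \<otimes> x [^] Suc k)"
      unfolding nat_pow_Suc2[OF assms(1)] by (simp add: m_assoc)
    finally show ?case ..
  qed
  \<comment> \<open>In degree \<open>m\<close> the monomial homogenises to the power of
    \<open>w\<close> and the constant 1 to the power of \<open>a\<close>; the difference is written
    as a sum to apply linearity.\<close>
  from this[of m] have "c ^ m \<odot> (y [^] m \<otimes> x [^] m) = hom_eval w a m (monom 1 m + Polynomial.smult (- 1) 1)"
    unfolding prod_roots_of_unity[OF prim]
    by (simp only: Polynomial.smult_minus_left Polynomial.smult_1_left diff_conv_add_uminus)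
  also have "\<dots> = w [^] m \<oplus> (- 1) \<odot> (a [^] m)"
    by (simp only: hom_eval_add hom_eval_smult hom_eval_1 hom_eval_monom assms(1-3) \<open>w \<in> carrier A\<close>)
  finally have "a [^] m \<oplus> c ^ m \<odot> (y [^] m \<otimes> x [^] m)
      = w [^] m \<oplus> (1 \<odot> (a [^] m) \<oplus> (- 1) \<odot> (a [^] m))"
    by (simp add: a_ac)
  also have "\<dots> = w [^] m"
    by (simp only: smult_add_left[symmetric] nat_pow_closed assms) simp
  finally show ?thesis ..
qed

text \<open>Stated for any families satisfying the relations. The induction starts at the empty sum,
  index 0, so that index 1 is an ordinary step.\<close>

lemma euclidean_omega_power:
  fixes q :: 'k and x y :: "nat \<Rightarrow> 'a"
  defines "c \<equiv> 1 - q powi (-2)"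
  defines "\<omega> \<equiv> (\<lambda>i. \<Oplus>l\<in>{1..i}. c \<odot> (y l \<otimes> x l))"
  assumes q: "q \<noteq> 0" and prim: "primitive_root_of_unity m (q ^ 2)"
    and x [simp]: "\<And>i. i \<in> {1..n} \<Longrightarrow> x i \<in> carrier A"
    and y [simp]: "\<And>i. i \<in> {1..n} \<Longrightarrow> y i \<in> carrier A"
    and xx: "\<And>i j. i \<in> {1..n} \<Longrightarrow> j \<in> {1..n} \<Longrightarrow> i < j \<Longrightarrow> x i \<otimes> x j = q \<odot> (x j \<otimes> x i)"
    and yy: "\<And>i j. i \<in> {1..n} \<Longrightarrow> j \<in> {1..n} \<Longrightarrow> i < j \<Longrightarrow>
      y i \<otimes> y j = inverse q \<odot> (y j \<otimes> y i)"
    and xy: "\<And>i j. i \<in> {1..n} \<Longrightarrow> j \<in> {1..n} \<Longrightarrow> i \<noteq> j \<Longrightarrow>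
      x i \<otimes> y j = inverse q \<odot> (y j \<otimes> x i)"
    and xy_same: "\<And>i. i \<in> {1..n} \<Longrightarrow>
      x i \<otimes> y i = y i \<otimes> x i \<oplus> (\<Oplus>l\<in>{1..<i}. c \<odot> (y l \<otimes> x l))"
    and "i \<le> n"
  shows "\<omega> i [^] m = c ^ m \<odot> (\<Oplus>l\<in>{1..i}. y l [^] m \<otimes> x l [^] m)"
  using \<open>i \<le> n\<close>
proof (induction i)
  case 0
  \<comment> \<open>Positivity makes the \<open>m\<close>-th power of the empty sum zero.\<close>
  have "m > 0"
    using prim by (simp add: primitive_root_of_unity_def)
  then show ?case
    by (simp add: \<omega>_def nat_pow_zero)
next
  case (Suc i)
  have \<omega>_closed [simp]: "\<omega> k \<in> carrier A" if "k \<le> n" for k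
    using that by (auto simp: \<omega>_def intro!: finsum_closed)
  have \<omega>_Suc: "\<omega> (Suc k) = \<omega> k \<oplus> c \<odot> (y (Suc k) \<otimes> x (Suc k))" if "k < n" for k
  proof -
    have "(\<lambda>l. c \<odot> (y l \<otimes> x l)) \<in> {1..k} \<rightarrow> carrier A"
      using that by auto
    then show ?thesis
      using that by (simp add: \<omega>_def atLeastAtMostSuc_conv a_comm)
  qed
  \<comment> \<open>For l < j, moving \<open>x j\<close> leftwards past \<open>x l\<close> and then
    \<open>y l\<close> costs one factor \<open>q\<close> each. As l stays below j, only relations
    between different indices occur.\<close>
  have \<omega>x: "\<omega> k \<otimes> x j = q ^ 2 \<odot> (x j \<otimes> \<omega> k)" if "k < j" "j \<le> n" for j k
    using that
  proof (induction k)
    case 0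
    then show ?case by (simp add: \<omega>_def)
  next
    case (Suc k)
    let ?l = "Suc k"
    have [simp]: "x j \<in> carrier A" "x ?l \<in> carrier A" "y ?l \<in> carrier A"
      using Suc.prems by auto
    have yx: "y ?l \<otimes> x j = q \<odot> (x j \<otimes> y ?l)"
      using xy[of j ?l] Suc.prems q by simp
    have "y ?l \<otimes> x ?l \<otimes> x j = q \<odot> (y ?l \<otimes> x j \<otimes> x ?l)"
      using xx[of ?l j] Suc.prems by (simp add: m_assoc)
    also have "\<dots> = q ^ 2 \<odot> (x j \<otimes> (y ?l \<otimes> x ?l))"
      by (simp add: yx m_assoc power2_eq_square)
    finally show ?case
      using Suc by (simp add: \<omega>_Suc l_distr r_distr smult_add_right mult.commute)
  qed
  \<comment> \<open>Likewise \<open>y j\<close> gains one \<open>q\<close> passing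
    \<open>y l\<close> and another passing \<open>x l\<close>.\<close>
  have y\<omega>: "y j \<otimes> \<omega> k = q ^ 2 \<odot> (\<omega> k \<otimes> y j)" if "k < j" "j \<le> n" for j k
    using that
  proof (induction k)
    case 0
    then show ?case by (simp add: \<omega>_def)
  next
    case (Suc k)
    let ?l = "Suc k"
    have [simp]: "y j \<in> carrier A" "x ?l \<in> carrier A" "y ?l \<in> carrier A"
      using Suc.prems by auto
    have yy': "y j \<otimes> y ?l = q \<odot> (y ?l \<otimes> y j)"
      using yy[of ?l j] Suc.prems q by simp
    have yx: "y j \<otimes> x ?l = q \<odot> (x ?l \<otimes> y j)"
      using xy[of ?l j] Suc.prems q by simp
    have "y j \<otimes> (y ?l \<otimes> x ?l) = q \<odot> (y ?l \<otimes> (y j \<otimes> x ?l))"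
      by (simp add: m_assoc[symmetric] yy')
    also have "\<dots> = q ^ 2 \<odot> (y ?l \<otimes> x ?l \<otimes> y j)"
      by (simp add: yx m_assoc power2_eq_square)
    finally show ?case
      using Suc by (simp add: \<omega>_Suc l_distr r_distr smult_add_right mult.commute)
  qed
  \<comment> \<open>The correction sum over l < \<open>Suc i\<close> in the equal-index relation is
    exactly \<open>\<omega> i\<close>.\<close>
  have "x (Suc i) \<otimes> y (Suc i) = y (Suc i) \<otimes> x (Suc i) \<oplus> \<omega> i"
    using xy_same[of "Suc i"] Suc.prems by (simp add: \<omega>_def atLeastLessThanSuc_atLeastAtMost)
  moreover have "c = 1 - inverse (q ^ 2)"
    by (simp add: c_def power_int_def power_inverse)
  ultimately have "\<omega> (Suc i) [^] m
      = \<omega> i [^] m \<oplus> c ^ m \<odot> (y (Suc i) [^] m \<otimes> x (Suc i) [^] m)"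
    using q prim Suc.prems \<omega>x[of i "Suc i"] y\<omega>[of i "Suc i"]
    by (intro scaled_product_power \<omega>_Suc) auto
  also have "\<dots> = c ^ m \<odot> (\<Oplus>l\<in>{1..Suc i}. y l [^] m \<otimes> x l [^] m)"
  proof -
    have "(\<lambda>l. y l [^] m \<otimes> x l [^] m) \<in> {1..i} \<rightarrow> carrier A"
      using Suc.prems by auto
    then show ?thesis
      using Suc by (simp add: atLeastAtMostSuc_conv smult_add_right a_comm)
  qed
  finally show ?case .
qed

end

section \<open>The quotient algebra\<close>

lemma quotient_algebra_simps:
  shows carrier_quotient_algebra: "carrier (quotient_algebra A I) = a_rcosets\<^bsub>A\<^esub> I"
    and mult_quotient_algebra: "mult (quotient_algebra A I) = rcoset_mult A I"
    and one_quotient_algebra: "one (quotient_algebra A I) = I +>\<^bsub>A\<^esub> \<one>\<^bsub>A\<^esub>"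
    and zero_quotient_algebra: "zero (quotient_algebra A I) = I"
    and add_quotient_algebra: "add (quotient_algebra A I) = set_add A"
    and smult_quotient_algebra:
      "smult (quotient_algebra A I) = (\<lambda>c X. \<Union>a\<in>X. I +>\<^bsub>A\<^esub> (c \<odot>\<^bsub>A\<^esub> a))"
  by (simp_all add: quotient_algebra_def ring.defs module.defs FactRing_def)

locale algebra_ideal = assoc_algebra A + ideal I A
  for A :: "('k::field, 'a) module" (structure) and I
begin

abbreviation "Q \<equiv> quotient_algebra A I"

lemma coset_closed: "u \<in> carrier A \<Longrightarrow> I +> u \<in> carrier Q"
  by (simp add: carrier_quotient_algebra a_rcosetsI a_subset)

lemma coset_cases:
  assumes "X \<in> carrier Q"
  obtains u where "u \<in> carrier A" "X = I +> u"
  using assms by (auto simp: carrier_quotient_algebra A_RCOSETS_def')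

lemma coset_mult: "u \<in> carrier A \<Longrightarrow> v \<in> carrier A \<Longrightarrow> (I +> u) \<otimes>\<^bsub>Q\<^esub> (I +> v) = I +> (u \<otimes> v)"
  by (simp add: mult_quotient_algebra rcoset_mult_add)

lemma coset_add: "u \<in> carrier A \<Longrightarrow> v \<in> carrier A \<Longrightarrow> (I +> u) \<oplus>\<^bsub>Q\<^esub> (I +> v) = I +> (u \<oplus> v)"
  by (simp add: add_quotient_algebra a_rcos_sum)

text \<open>A ring ideal absorbs scalars because
  \<open>c \<odot> h = (c \<odot> \<one>) \<otimes> h\<close>. Hence all representatives yield the
  same coset, and the union defining the action collapses to it.\<close>

lemma coset_smult:
  assumes u: "u \<in> carrier A"
  shows "c \<odot>\<^bsub>Q\<^esub> (I +> u) = I +> (c \<odot> u)"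
proof -
  have "I +> (c \<odot> v) = I +> (c \<odot> u)" if v: "v \<in> I +> u" for v
  proof -
    obtain h where h: "h \<in> I" "v = h \<oplus> u"
      using v by (auto simp: a_r_coset_def')
    then have hA: "h \<in> carrier A"
      using a_subset by auto
    have "c \<odot> h = (c \<odot> \<one>) \<otimes> h"
      using hA by simp
    then have "c \<odot> h \<in> I"
      using h(1) by (metis I_l_closed one_closed smult_closed)
    then have "c \<odot> v \<in> I +> (c \<odot> u)"
      using h hA u by (auto simp: a_r_coset_def' smult_add_right)
    then show ?thesis
      using u by (metis a_repr_independence smult_closed a_subgroup)
  qed
  moreover have "u \<in> I +> u"
    using u a_rcos_self by blast
  ultimately show ?thesis
    unfolding smult_quotient_algebra by (intro UN_constant_eq ballI)
qed

lemma coset_zero: "\<zero>\<^bsub>Q\<^esub> = I +> \<zero>"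
  by (simp add: zero_quotient_algebra a_subset)

lemma coset_one: "\<one>\<^bsub>Q\<^esub> = I +> \<one>"
  by (rule one_quotient_algebra)

lemma ring_quotient: "ring Q"
proof (intro ringI abelian_groupI monoidI)
  fix X assume "X \<in> carrier Q"
  then obtain u where u: "u \<in> carrier A" "X = I +> u"
    by (rule coset_cases)
  then have "(I +> (\<ominus> u)) \<oplus>\<^bsub>Q\<^esub> X = \<zero>\<^bsub>Q\<^esub>"
    by (simp add: coset_add coset_zero l_neg)
  then show "\<exists>Y\<in>carrier Q. Y \<oplus>\<^bsub>Q\<^esub> X = \<zero>\<^bsub>Q\<^esub>"
    using u coset_closed by blast
qed (auto elim!: coset_cases simp: coset_closed coset_add coset_mult coset_zero coset_one
    a_ac m_assoc l_distr r_distr)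

lemma assoc_algebra_quotient: "assoc_algebra Q"
  by (intro assoc_algebra.intro ring_quotient assoc_algebra_axioms.intro)
    (auto elim!: coset_cases simp: coset_closed coset_mult coset_add coset_smult
      smult_add_left smult_add_right)

lemma coset_eqI:
  assumes "u \<in> carrier A" "v \<in> carrier A" "u \<ominus> v \<in> I"
  shows "I +> u = I +> v"
  using assms quotient_eq_iff_same_a_r_cos is_ideal by blast

lemma coset_finsum:
  assumes "finite L" "f \<in> L \<rightarrow> carrier A"
  shows "I +> (\<Oplus>l\<in>L. f l) = (\<Oplus>\<^bsub>Q\<^esub>l\<in>L. I +> f l)"
proof -
  interpret Q: ring Q
    by (rule ring_quotient)
  show ?thesis
    using assms
  proof (induction L rule: finite_induct)
    case empty
    then show ?case
      by (simp add: zero_quotient_algebra a_subset)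
  next
    case (insert l L)
    then have "(\<lambda>l. I +> f l) \<in> L \<rightarrow> carrier Q" "I +> f l \<in> carrier Q"
      by (auto intro: coset_closed)
    then show ?case
      using insert by (simp add: coset_add[symmetric] Pi_iff)
  qed
qed

end

section \<open>The free algebra\<close>

text \<open>A scalar is supported on the empty word, which is neutral for concatenation on both
  sides. Induction on the support reduces the claim to a single word.\<close>

lemma scalar_mult_commute: "f * scalar c = scalar c * (f :: 'a word \<Rightarrow>\<^sub>0 'k::field)"
proof (induction f rule: Poly_Mapping.update_induct)
  case const
  then show ?case by simp
next
  case (update f w a)
  \<comment> \<open>The word \<open>w\<close> is outside the support of \<open>f\<close>, so
    updating there is the same as adding.\<close>
  have "Poly_Mapping.update w a f = f + Poly_Mapping.single w a"
    using update by (intro poly_mapping_eqI)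
      (auto simp: lookup_update lookup_add lookup_single in_keys_iff when_def)
  moreover have "Poly_Mapping.single w a * scalar c = scalar c * Poly_Mapping.single w a"
    by (simp add: scalar_def mult_single mult.commute)
  ultimately show ?case
    using update by (simp add: algebra_simps)
qed

lemma scalar_add: "scalar (c + d) = scalar c + scalar d"
  by (simp add: scalar_def single_add)

lemma scalar_mult: "scalar (c * d) = scalar c * scalar d"
  by (simp add: scalar_def mult_single)

lemma scalar_1: "scalar 1 = 1"
  by (simp add: scalar_def)

lemma free_algebra_simps [simp]:
  shows "mult (free_algebra S) = (*)" "one (free_algebra S) = 1" "zero (free_algebra S) = 0"
    "add (free_algebra S) = (+)" "smult (free_algebra S) = (\<lambda>c f. scalar c * f)"
  by (simp_all add: free_algebra_def)

lemma mem_free_algebra: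
  "f \<in> carrier (free_algebra S) \<longleftrightarrow> (\<forall>w\<in>Poly_Mapping.keys f. set (letters w) \<subseteq> S)"
  by (simp add: free_algebra_def)

lemma free_algebra_closed [simp, intro]:
  shows "0 \<in> carrier (free_algebra S)" "1 \<in> carrier (free_algebra S)"
    "scalar c \<in> carrier (free_algebra S)"
    "g \<in> S \<Longrightarrow> generator g \<in> carrier (free_algebra S)"
    "f \<in> carrier (free_algebra S) \<Longrightarrow> - f \<in> carrier (free_algebra S)"
  by (auto simp: mem_free_algebra scalar_def generator_def zero_word_def
      simp flip: single_one split: if_splits)

lemma free_algebra_add_closed [simp, intro]:
  "f \<in> carrier (free_algebra S) \<Longrightarrow> g \<in> carrier (free_algebra S) \<Longrightarrow>
    f + g \<in> carrier (free_algebra S)"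
  using keys_add[of f g] by (auto simp: mem_free_algebra)

lemma free_algebra_mult_closed [simp, intro]:
  assumes "f \<in> carrier (free_algebra S)" "g \<in> carrier (free_algebra S)"
  shows "f * g \<in> carrier (free_algebra S)"
  unfolding mem_free_algebra
proof
  fix w assume "w \<in> Poly_Mapping.keys (f * g)"
  then obtain u v where "w = u + v" "u \<in> Poly_Mapping.keys f" "v \<in> Poly_Mapping.keys g"
    using keys_mult[of f g] by auto
  then show "set (letters w) \<subseteq> S"
    using assms by (auto simp: mem_free_algebra plus_word_def)
qed

lemma assoc_algebra_free_algebra: "assoc_algebra (free_algebra S)"
proof (intro assoc_algebra.intro assoc_algebra_axioms.intro ringI abelian_groupI monoidI)
  fix f assume "f \<in> carrier (free_algebra S)"
  then show "\<exists>g\<in>carrier (free_algebra S). g \<oplus>\<^bsub>free_algebra S\<^esub> f = \<zero>\<^bsub>free_algebra S\<^esub>"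
    by (intro bexI[of _ "- f"]) auto
next
  \<comment> \<open>Among the algebra laws, this one moves a scalar past an element and so rests on
    centrality.\<close>
  fix f g c
  show "f \<otimes>\<^bsub>free_algebra S\<^esub> (c \<odot>\<^bsub>free_algebra S\<^esub> g) = c \<odot>\<^bsub>free_algebra S\<^esub> (f \<otimes>\<^bsub>free_algebra S\<^esub> g)"
    using scalar_mult_commute[of f c] by (simp flip: mult.assoc)
qed (auto simp: algebra_simps scalar_add scalar_mult scalar_1)

text \<open>This and the next lemma translate the record operations into the type class operations
  in which the relators are written.\<close>

lemma free_algebra_finsum:
  assumes "finite L" "\<And>l. l \<in> L \<Longrightarrow> f l \<in> carrier (free_algebra S)"
  shows "(\<Oplus>\<^bsub>free_algebra S\<^esub>l\<in>L. f l) = sum f L"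
proof -
  interpret assoc_algebra "free_algebra S"
    by (rule assoc_algebra_free_algebra)
  show ?thesis
    using assms by (induction L rule: finite_induct) (auto simp: Pi_iff)
qed

lemma free_algebra_minus:
  assumes "f \<in> carrier (free_algebra S)" "g \<in> carrier (free_algebra S)"
  shows "f \<ominus>\<^bsub>free_algebra S\<^esub> g = f - g"
proof -
  interpret assoc_algebra "free_algebra S"
    by (rule assoc_algebra_free_algebra)
  have "\<ominus>\<^bsub>free_algebra S\<^esub> g = - g"
    using assms by (intro minus_equality) auto
  then show ?thesis
    by (simp add: a_minus_def)
qed

lemma free_algebra_sum_closed [simp, intro]:
  "(\<And>l. l \<in> L \<Longrightarrow> f l \<in> carrier (free_algebra S)) \<Longrightarrow> sum f L \<in> carrier (free_algebra S)"
  by (induction L rule: infinite_finite_induct) auto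

lemma free_algebra_diff_closed [simp, intro]:
  "f \<in> carrier (free_algebra S) \<Longrightarrow> g \<in> carrier (free_algebra S) \<Longrightarrow>
    f - g \<in> carrier (free_algebra S)"
  using free_algebra_add_closed[of f S "- g"] by simp

theorem theorem5p2:
  fixes q :: "'k::alg_closed_field" and m n i :: nat
  assumes "m > 1" and "odd m"
    and "q \<noteq> 0" and "primitive_root_of_unity m q"
    and "n \<ge> 1" and "i \<in> {1..n}"
  shows "oq_omega n q i [^]\<^bsub>Oq n q\<^esub> m =
    ((1 - q powi (-2)) ^ m) \<odot>\<^bsub>Oq n q\<^esub>
      (\<Oplus>\<^bsub>Oq n q\<^esub>l\<in>{1..i}. (oq_y n q l [^]\<^bsub>Oq n q\<^esub> m) \<otimes>\<^bsub>Oq n q\<^esub> (oq_x n q l [^]\<^bsub>Oq n q\<^esub> m))"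
proof -
  let ?F = "free_algebra (oq_gens n) :: ('k, gen word \<Rightarrow>\<^sub>0 'k) module"
  let ?I = "oq_ideal n q"
  interpret F: assoc_algebra ?F
    by (rule assoc_algebra_free_algebra)
  have X [simp, intro]: "fX j \<in> carrier ?F" and Y [simp, intro]: "fY j \<in> carrier ?F"
    if "j \<in> {1..n}" for j
    using that by (auto simp: oq_gens_def)
  have rel: "oq_relators n q \<subseteq> carrier ?F"
    unfolding oq_relators_def
    by (auto intro!: free_algebra_diff_closed free_algebra_mult_closed free_algebra_add_closed
        free_algebra_sum_closed X Y)
  interpret algebra_ideal ?F ?I
    unfolding oq_ideal_def
    by (intro algebra_ideal.intro assoc_algebra_free_algebra F.genideal_ideal rel)
  have Q: "Q = Oq n q"
    by (simp add: Oq_def)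
  interpret Q: assoc_algebra "Oq n q"
    using assoc_algebra_quotient unfolding Q .
  \<comment> \<open>Each relator is a difference lying in the generated ideal, so its two sides have
    the same coset.\<close>
  have eq: "?I +>\<^bsub>?F\<^esub> f = ?I +>\<^bsub>?F\<^esub> g"
    if "f - g \<in> oq_relators n q" "f \<in> carrier ?F" "g \<in> carrier ?F" for f g
    using that F.genideal_self[OF rel]
    by (intro coset_eqI) (auto simp: free_algebra_minus oq_ideal_def)
  \<comment> \<open>These rules turn computations with cosets into computations with representatives
    in the free algebra.\<close>
  note push = coset_closed[unfolded Q] coset_mult[unfolded Q, simplified]
    coset_add[unfolded Q, simplified] coset_smult[unfolded Q, simplified]
  show ?thesis
    unfolding oq_omega_def
  proof (rule Q.euclidean_omega_power[where n = n])
    show "primitive_root_of_unity m (q ^ 2)"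
      using assms primitive_root_of_unity_square by blast
    show "oq_x n q j \<in> carrier (Oq n q)" "oq_y n q j \<in> carrier (Oq n q)" if "j \<in> {1..n}" for j
      using that by (auto simp: oq_x_def oq_y_def push)
    show "oq_x n q j \<otimes>\<^bsub>Oq n q\<^esub> oq_x n q k = q \<odot>\<^bsub>Oq n q\<^esub> (oq_x n q k \<otimes>\<^bsub>Oq n q\<^esub> oq_x n q j)"
      if "j \<in> {1..n}" "k \<in> {1..n}" "j < k" for j k
    proof -
      have "?I +>\<^bsub>?F\<^esub> (fX j * fX k) = ?I +>\<^bsub>?F\<^esub> (scalar q * (fX k * fX j))"
        using that by (intro eq free_algebra_mult_closed free_algebra_closed(3) X Y)
          (unfold oq_relators_def, blast)
      then show ?thesis
        using that by (simp add: oq_x_def push)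
    qed
    show "oq_y n q j \<otimes>\<^bsub>Oq n q\<^esub> oq_y n q k
        = inverse q \<odot>\<^bsub>Oq n q\<^esub> (oq_y n q k \<otimes>\<^bsub>Oq n q\<^esub> oq_y n q j)"
      if "j \<in> {1..n}" "k \<in> {1..n}" "j < k" for j k
    proof -
      have "?I +>\<^bsub>?F\<^esub> (fY j * fY k) = ?I +>\<^bsub>?F\<^esub> (scalar (inverse q) * (fY k * fY j))"
        using that by (intro eq free_algebra_mult_closed free_algebra_closed(3) X Y)
          (unfold oq_relators_def, blast)
      then show ?thesis
        using that by (simp add: oq_y_def push)
    qed
    show "oq_x n q j \<otimes>\<^bsub>Oq n q\<^esub> oq_y n q k
        = inverse q \<odot>\<^bsub>Oq n q\<^esub> (oq_y n q k \<otimes>\<^bsub>Oq n q\<^esub> oq_x n q j)"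
      if "j \<in> {1..n}" "k \<in> {1..n}" "j \<noteq> k" for j k
    proof -
      have "?I +>\<^bsub>?F\<^esub> (fX j * fY k) = ?I +>\<^bsub>?F\<^esub> (scalar (inverse q) * (fY k * fX j))"
        using that by (intro eq free_algebra_mult_closed free_algebra_closed(3) X Y)
          (unfold oq_relators_def, blast)
      then show ?thesis
        using that by (simp add: oq_x_def oq_y_def push)
    qed
    show "oq_x n q j \<otimes>\<^bsub>Oq n q\<^esub> oq_y n q j = oq_y n q j \<otimes>\<^bsub>Oq n q\<^esub> oq_x n q j \<oplus>\<^bsub>Oq n q\<^esub>
        (\<Oplus>\<^bsub>Oq n q\<^esub>l\<in>{1..<j}. (1 - q powi (-2)) \<odot>\<^bsub>Oq n q\<^esub> (oq_y n q l \<otimes>\<^bsub>Oq n q\<^esub> oq_x n q l))"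
      if j: "j \<in> {1..n}" for j
    proof -
      let ?t = "\<lambda>l. scalar (1 - q powi (-2)) * (fY l * fX l) :: gen word \<Rightarrow>\<^sub>0 'k"
      have t: "?t l \<in> carrier ?F" if "l \<in> {1..<j}" for l
        using that j by (intro free_algebra_mult_closed free_algebra_closed X Y) auto
      \<comment> \<open>The equal-index relator contains a sum in the free algebra. Exchanging sum
        and coset matches it with the sum in the quotient.\<close>
      have "?I +>\<^bsub>?F\<^esub> sum ?t {1..<j} = (\<Oplus>\<^bsub>Oq n q\<^esub>l\<in>{1..<j}. ?I +>\<^bsub>?F\<^esub> ?t l)"
        using t coset_finsum[of "{1..<j}" ?t] free_algebra_finsum[of "{1..<j}" ?t "oq_gens n"]
        unfolding Q by auto
      also have "\<dots> = (\<Oplus>\<^bsub>Oq n q\<^esub>l\<in>{1..<j}.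
          (1 - q powi (-2)) \<odot>\<^bsub>Oq n q\<^esub> (oq_y n q l \<otimes>\<^bsub>Oq n q\<^esub> oq_x n q l))"
        using j by (intro Q.finsum_cong') (auto simp: oq_x_def oq_y_def push)
      finally have sum: "?I +>\<^bsub>?F\<^esub> sum ?t {1..<j} = \<dots>" .
      have "sum ?t {1..<j} \<in> carrier ?F"
        using t by blast
      moreover from this have "?I +>\<^bsub>?F\<^esub> (fX j * fY j) = ?I +>\<^bsub>?F\<^esub> (fY j * fX j + sum ?t {1..<j})"
        using j by (intro eq free_algebra_mult_closed free_algebra_add_closed X Y)
          (unfold oq_relators_def, blast)
      ultimately show ?thesis
        unfolding sum[symmetric] using j by (simp add: oq_x_def oq_y_def push)
    qed
  qed (use assms in auto)
qed

end
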